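(* Let $n<\omega$ and let $X$ be a set with $|X|\geq\aleph_n$. If $\mathcal F$ is a family of finite subsets of $X$ such that every finite subset of $X$ is contained in some member of $\mathcal F$, then the VC-dimension of $\mathcal F$ is $>n$. Consequently, if $|X|\geq\aleph_\omega$, any such family $\mathcal F$ has infinite VC-dimension (i.e., $\mathcal F$ is not a VC-class).
   Context: For a set $X$ and $\mathcal F\subseteq\mathcal P(X)$, a subset $A\subseteq X$ is shattered by $\mathcal F$ if for every $S\subseteq A$ there is $F\in\mathcal F$ with $F\cap A=S$. $\mathcal F$ is a VC-class if for some $n<\omega$ no subset of $X$ of size $n$ is shattered; its VC-dimension is then the smallest $n$ such that no subset of size $n+1$ is shattered, and it is $\infty$ if no such $n$ exists. *)

theory Defs
  imports Main "HOL-Library.Extended_Nat"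
begin

unbundle cardinal_syntax

definition shattered :: "'a set set \<Rightarrow> 'a set \<Rightarrow> bool" where
  "shattered F A \<longleftrightarrow> (\<forall>S\<subseteq>A. \<exists>B\<in>F. B \<inter> A = S)"

definition shatters_some_of_size :: "'a set \<Rightarrow> 'a set set \<Rightarrow> nat \<Rightarrow> bool" where
  "shatters_some_of_size X F n \<longleftrightarrow>
     (\<exists>A\<subseteq>X. finite A \<and> card A = n \<and> shattered F A)"

definition vc_class :: "'a set \<Rightarrow> 'a set set \<Rightarrow> bool" where
  "vc_class X F \<longleftrightarrow> (\<exists>n. \<not> shatters_some_of_size X F n)"

definition vc_dim :: "'a set \<Rightarrow> 'a set set \<Rightarrow> enat" where
  "vc_dim X F =
     (if vc_class X F then enat (LEAST n. \<not> shatters_some_of_size X F (n + 1)) else \<infinity>)"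

text \<open>
  \<open>cardSuc\<close> maps a relation on \<open>'a\<close> to one on \<open>'a set\<close>, so it cannot be iterated within a single
  type, and there need not be a type that is large enough for all alephs. Hence \<open>\<aleph>\<^sub>n\<close> is rendered as
  a property of cardinals \<open>r\<close> on a given type: \<open>is_aleph n r\<close> says that \<open>r\<close> is a
  cardinal equal to \<open>\<aleph>\<^sub>n\<close>. Restricting the predecessor \<open>s\<close> to the same type as \<open>r\<close> loses nothing,
  because a type that carries \<open>\<aleph>\<^sub>n\<^sub>+\<^sub>1\<close> also carries \<open>\<aleph>\<^sub>n\<close>.
\<close>

primrec is_aleph :: "nat \<Rightarrow> 'a rel \<Rightarrow> bool" where
  "is_aleph 0 r \<longleftrightarrow> Card_order r \<and> r =o natLeq"
| "is_aleph (Suc n) r \<longleftrightarrow> Card_order r \<and> (\<exists>s :: 'a rel. is_aleph n s \<and> r =o cardSuc s)"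

lemma is_aleph_unique:
  fixes r :: "'a rel" and s :: "'b rel"
  assumes "is_aleph n r" and "is_aleph n s"
  shows "r =o s"
  using assms
proof (induction n arbitrary: r s)
  case 0
  then show ?case
    by (auto intro: ordIso_transitive ordIso_symmetric)
next
  case (Suc n)
  then obtain r' :: "'a rel" and s' :: "'b rel"
    where r': "is_aleph n r'" "r =o cardSuc r'" and s': "is_aleph n s'" "s =o cardSuc s'"
    by auto
  have "Card_order r'" "Card_order s'"
    using r'(1) s'(1) by (cases n; simp)+
  then have "cardSuc r' =o cardSuc s'"
    using Suc.IH[OF r'(1) s'(1)] by (simp add: cardSuc_invar_ordIso)
  then show ?case
    using r'(2) s'(2) by (meson ordIso_symmetric ordIso_transitive)
qed

definition aleph_le :: "nat \<Rightarrow> 'a rel \<Rightarrow> bool" where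
  "aleph_le n t \<longleftrightarrow> (\<exists>r :: 'a rel. is_aleph n r \<and> r \<le>o t)"

text \<open>
  \<open>\<aleph>\<^sub>\<omega>\<close> is the least cardinal above all \<open>\<aleph>\<^sub>n\<close>.
\<close>

definition is_aleph_omega :: "'a rel \<Rightarrow> bool" where
  "is_aleph_omega r \<longleftrightarrow>
     Card_order r \<and> (\<forall>n. aleph_le n r) \<and>
     (\<forall>t :: 'a rel. Card_order t \<and> (\<forall>n. aleph_le n t) \<longrightarrow> r \<le>o t)"

definition aleph_omega_le :: "'a rel \<Rightarrow> bool" where
  "aleph_omega_le t \<longleftrightarrow> (\<exists>r :: 'a rel. is_aleph_omega r \<and> r \<le>o t)"

end

theory Submission
  imports Defs "HOL-Algebra.Free_Abelian_Groups"
begin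

text \<open>
  Choose for every finite \<open>S \<subseteq> X\<close> a member \<open>g S \<supseteq> S\<close> of the family. A finite set \<open>A\<close> with
  \<open>g S \<inter> A \<subseteq> S\<close> for all \<open>S \<subseteq> A\<close> is shattered, and such a free set of size \<open>n + 1\<close>
  exists for every finite-set-valued \<open>g\<close> once \<open>|X| \<ge> \<aleph>\<^sub>n\<close> (Kuratowski). For the induction step, take
  \<open>Y \<subseteq> X\<close> of size \<open>\<aleph>\<^sub>n\<close> and a point \<open>x\<close> of \<open>X\<close> outside \<open>Y\<close> and outside all \<open>g S\<close>
  with \<open>S \<subseteq> Y\<close> finite. If \<open>A \<subseteq> Y\<close> is free for \<open>S \<mapsto> g S \<union> g (S \<union> {x})\<close>, then \<open>A \<union> {x}\<close>
  is free for \<open>g\<close>.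
\<close>

lemma obtain_subset_of_cardinality:
  assumes "Card_order r" and "r \<le>o |X|"
  obtains Y where "Y \<subseteq> X" and "r =o |Y|"
proof -
  have field: "|Field r| =o r"
    using assms(1) by (rule card_of_Field_ordIso)
  then have "|Field r| \<le>o |X|"
    using assms(2) by (rule ordIso_ordLeq_trans)
  then obtain Y where "Y \<subseteq> X" and "|Field r| =o |Y|"
    by (auto simp: internalize_card_of_ordLeq2[of "Field r" X])
  moreover have "r =o |Y|"
    using ordIso_symmetric[OF field] \<open>|Field r| =o |Y|\<close> by (rule ordIso_transitive)
  ultimately show thesis
    using that by blast
qed

lemma Fpow_subset:
  assumes "A \<in> Fpow X" and "B \<subseteq> A"
  shows "B \<in> Fpow X"
  using assms finite_subset[OF assms(2)] by (auto simp: Fpow_def)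

lemma card_of_ordLess_imp_not_subset: "|A| <o |X| \<Longrightarrow> \<not> X \<subseteq> A"
  using card_of_mono1 not_ordLess_ordLeq by blast

lemma obtain_point_avoiding_small_family:
  assumes "infinite Y" and "|Y| <o |X|"
    and "|I| \<le>o |Y|" and "\<And>i. i \<in> I \<Longrightarrow> |B i| \<le>o |Y|"
  obtains x where "x \<in> X" and "x \<notin> Y" and "\<And>i. i \<in> I \<Longrightarrow> x \<notin> B i"
proof -
  have "|\<Union>i\<in>I. B i| \<le>o |Y|"
    using assms by (intro card_of_UNION_ordLeq_infinite) auto
  then have "|\<Union>i\<in>I. B i| <o |X|"
    using assms(2) by (rule ordLeq_ordLess_trans)
  moreover have "infinite X"
    using card_of_ordLeq_infinite[OF ordLess_imp_ordLeq[OF assms(2)]] assms(1) by blast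
  ultimately have "|Y \<union> (\<Union>i\<in>I. B i)| <o |X|"
    using assms(2) by (intro card_of_Un_ordLess_infinite)
  then have "\<not> X \<subseteq> Y \<union> (\<Union>i\<in>I. B i)"
    by (rule card_of_ordLess_imp_not_subset)
  with that show thesis by blast
qed

text \<open>
  For a cardinal \<open>r\<close> this says \<open>r\<^sup>+\<^sup>n \<le> |X|\<close>. A chain of subsets of increasing cardinality replaces
  the iterated \<open>cardSuc\<close>, whose type would change at each step.
\<close>

primrec cardSuc_iter_ordLeq :: "'b rel \<Rightarrow> nat \<Rightarrow> 'a set \<Rightarrow> bool" where
  "cardSuc_iter_ordLeq r 0 X \<longleftrightarrow> r \<le>o |X|"
| "cardSuc_iter_ordLeq r (Suc n) X \<longleftrightarrow> (\<exists>Y\<subseteq>X. |Y| <o |X| \<and> cardSuc_iter_ordLeq r n Y)"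

lemma cardSuc_iter_ordLeq_imp_ordLeq:
  "cardSuc_iter_ordLeq r n X \<Longrightarrow> r \<le>o |X|"
proof (induction n arbitrary: X)
  case (Suc n)
  then obtain Y where "Y \<subseteq> X" and "cardSuc_iter_ordLeq r n Y"
    by auto
  then show ?case
    using Suc.IH card_of_mono1 ordLeq_transitive by blast
qed simp

lemma is_aleph_Card_order: "is_aleph n r \<Longrightarrow> Card_order r"
  by (cases n) auto

lemma is_aleph_imp_cardSuc_iter_natLeq:
  fixes r :: "'a rel" and X :: "'a set"
  assumes "is_aleph n r" and "r \<le>o |X|"
  shows "cardSuc_iter_ordLeq natLeq n X"
  using assms
proof (induction n arbitrary: r X)
  case 0
  then show ?case
    by (auto intro: ordIso_ordLeq_trans ordIso_symmetric)
next
  case (Suc n)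
  then obtain s :: "'a rel" where s: "is_aleph n s" and "r =o cardSuc s"
    by auto
  with Suc.prems(2) have "cardSuc s \<le>o |X|"
    using ordIso_symmetric ordIso_ordLeq_trans by blast
  have card: "Card_order s"
    using s by (rule is_aleph_Card_order)
  have less: "s <o |X|"
    using cardSuc_greater[OF card] \<open>cardSuc s \<le>o |X|\<close> by (rule ordLess_ordLeq_trans)
  then obtain Y where "Y \<subseteq> X" and iso: "s =o |Y|"
    using obtain_subset_of_cardinality[OF card] ordLess_imp_ordLeq by metis
  moreover have "|Y| <o |X|"
    using ordIso_symmetric[OF iso] less by (rule ordIso_ordLess_trans)
  moreover have "cardSuc_iter_ordLeq natLeq n Y"
    using Suc.IH[OF s] iso ordIso_imp_ordLeq by blast
  ultimately show ?case by auto
qed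

lemma aleph_le_imp_cardSuc_iter_natLeq:
  "aleph_le n |X| \<Longrightarrow> cardSuc_iter_ordLeq natLeq n X"
  unfolding aleph_le_def using is_aleph_imp_cardSuc_iter_natLeq by blast

lemma aleph_omega_le_imp_aleph_le: "aleph_omega_le r \<Longrightarrow> aleph_le n r"
  unfolding aleph_omega_le_def is_aleph_omega_def aleph_le_def
  using ordLeq_transitive by blast

definition free_set :: "('a set \<Rightarrow> 'a set) \<Rightarrow> 'a set \<Rightarrow> bool" where
  "free_set g A \<longleftrightarrow> (\<forall>S\<subseteq>A. g S \<inter> A \<subseteq> S)"

lemma free_set_insert:
  assumes free: "free_set (\<lambda>S. g S \<union> g (insert x S)) A"
    and avoid: "\<And>S. S \<subseteq> A \<Longrightarrow> x \<notin> g S"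
  shows "free_set g (insert x A)"
  unfolding free_set_def
proof (intro allI impI)
  fix S assume S: "S \<subseteq> insert x A"
  show "g S \<inter> insert x A \<subseteq> S"
  proof (cases "x \<in> S")
    case True
    define T where "T = S - {x}"
    with S True have "S = insert x T" and "T \<subseteq> A" by auto
    with free have "g S \<inter> A \<subseteq> T"
      unfolding free_set_def by blast
    with \<open>S = insert x T\<close> show ?thesis by blast
  next
    case False
    with S have "S \<subseteq> A" by blast
    then have "g S \<inter> A \<subseteq> S" and "x \<notin> g S"
      using free avoid unfolding free_set_def by blast+
    then show ?thesis by blast
  qed
qed

text \<open>The partition relation \<open>(|X|, <\<omega>, r) \<rightarrow> m\<close> for set mappings on finite sets.\<close>

definition admits_free_sets :: "'b rel \<Rightarrow> nat \<Rightarrow> 'a set \<Rightarrow> bool" where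
  "admits_free_sets r m X \<longleftrightarrow>
     (\<forall>g. (\<forall>S\<in>Fpow X. |g S| <o r) \<longrightarrow> (\<exists>A\<in>Fpow X. card A = m \<and> free_set g A))"

lemma admits_free_sets_1:
  assumes "r \<le>o |X|"
  shows "admits_free_sets r 1 X"
  unfolding admits_free_sets_def
proof (intro allI impI)
  fix g :: "'b set \<Rightarrow> 'b set"
  assume "\<forall>S\<in>Fpow X. |g S| <o r"
  then have "|g {}| <o r"
    using empty_in_Fpow by blast
  then have "|g {}| <o |X|"
    using assms by (rule ordLess_ordLeq_trans)
  then obtain x where "x \<in> X" and "x \<notin> g {}"
    using card_of_ordLess_imp_not_subset by blast
  then show "\<exists>A\<in>Fpow X. card A = 1 \<and> free_set g A"
    by (intro bexI[of _ "{x}"]) (auto simp: free_set_def subset_singleton_iff Fpow_def)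
qed

lemma admits_free_sets_Suc:
  assumes r: "Cinfinite r" and "r \<le>o |Y|" and "Y \<subseteq> X" and "|Y| <o |X|"
    and Y: "admits_free_sets r m Y"
  shows "admits_free_sets r (Suc m) X"
  unfolding admits_free_sets_def
proof (intro allI impI)
  fix g :: "'b set \<Rightarrow> 'b set"
  assume small: "\<forall>S\<in>Fpow X. |g S| <o r"
  have "infinite Y"
    using cinfinite_mono[OF \<open>r \<le>o |Y|\<close>] r by (simp add: cinfinite_def)
  then have "|Fpow Y| \<le>o |Y|"
    by (intro ordIso_imp_ordLeq card_of_Fpow_infinite)
  have small_Y: "|g S| <o r" if "S \<in> Fpow Y" for S
    using that small Fpow_mono[OF \<open>Y \<subseteq> X\<close>] by blast
  have "|g S| \<le>o |Y|" if "S \<in> Fpow Y" for S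
    using ordLess_ordLeq_trans[OF small_Y[OF that] \<open>r \<le>o |Y|\<close>] by (rule ordLess_imp_ordLeq)
  then obtain x where x: "x \<in> X" "x \<notin> Y" and avoid: "\<And>S. S \<in> Fpow Y \<Longrightarrow> x \<notin> g S"
    using obtain_point_avoiding_small_family[OF \<open>infinite Y\<close> \<open>|Y| <o |X|\<close> \<open>|Fpow Y| \<le>o |Y|\<close>] by blast
  have "insert x S \<in> Fpow X" if "S \<in> Fpow Y" for S
    using that x(1) \<open>Y \<subseteq> X\<close> by (auto simp: Fpow_def)
  with small small_Y have "\<forall>S\<in>Fpow Y. |g S \<union> g (insert x S)| <o r"
    using r by (simp add: card_of_Un_ordLess_infinite_Field cinfinite_def)
  then obtain A where A: "A \<in> Fpow Y" "card A = m"
    and free: "free_set (\<lambda>S. g S \<union> g (insert x S)) A"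
    using Y[unfolded admits_free_sets_def, THEN spec, of "\<lambda>S. g S \<union> g (insert x S)"] by blast
  have "free_set g (insert x A)"
    using free avoid[OF Fpow_subset[OF A(1)]] by (rule free_set_insert)
  moreover have "card (insert x A) = Suc m" and "insert x A \<in> Fpow X"
    using A x \<open>Y \<subseteq> X\<close> by (auto simp: Fpow_def card_insert_if)
  ultimately show "\<exists>A\<in>Fpow X. card A = Suc m \<and> free_set g A"
    by blast
qed

theorem Kuratowski_free_set:
  assumes "Cinfinite r" and "cardSuc_iter_ordLeq r n X"
  shows "admits_free_sets r (Suc n) X"
  using assms(2)
proof (induction n arbitrary: X)
  case 0
  then show ?case
    using admits_free_sets_1 by auto
next
  case (Suc n)
  then obtain Y where Y: "Y \<subseteq> X" "|Y| <o |X|" "cardSuc_iter_ordLeq r n Y"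
    by auto
  have "r \<le>o |Y|"
    using Y(3) by (rule cardSuc_iter_ordLeq_imp_ordLeq)
  with assms(1) show ?case
    using Y(1,2) Suc.IH[OF Y(3)] by (rule admits_free_sets_Suc)
qed

lemma shattered_subset:
  assumes "shattered F A" and "B \<subseteq> A"
  shows "shattered F B"
  unfolding shattered_def
proof (intro allI impI)
  fix S assume "S \<subseteq> B"
  with assms obtain C where "C \<in> F" and "C \<inter> A = S"
    unfolding shattered_def by blast
  with \<open>S \<subseteq> B\<close> assms(2) show "\<exists>C\<in>F. C \<inter> B = S" by blast
qed

lemma shatters_some_of_size_antimono:
  assumes "shatters_some_of_size X F n" and "m \<le> n"
  shows "shatters_some_of_size X F m"
proof -
  obtain A where "A \<subseteq> X" and "card A = n" and "shattered F A"
    using assms(1) unfolding shatters_some_of_size_def by blast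
  moreover from this obtain B where "B \<subseteq> A" and "card B = m" and "finite B"
    using obtain_subset_with_card_n[of m A] assms(2) by blast
  moreover from calculation have "B \<subseteq> X" and "shattered F B"
    using shattered_subset by blast+
  ultimately show ?thesis
    unfolding shatters_some_of_size_def by blast
qed

lemma less_vc_dim_iff: "enat n < vc_dim X F \<longleftrightarrow> shatters_some_of_size X F (Suc n)"
proof (cases "vc_class X F")
  case True
  define d where "d = (LEAST m. \<not> shatters_some_of_size X F (m + 1))"
  have "\<exists>m. \<not> shatters_some_of_size X F (m + 1)"
    using True shatters_some_of_size_antimono le_add1 unfolding vc_class_def by blast
  then have "\<not> shatters_some_of_size X F (d + 1)"
    unfolding d_def by (rule LeastI_ex)
  then have "\<not> shatters_some_of_size X F (Suc n)" if "d \<le> n"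
    using that shatters_some_of_size_antimono[of X F "Suc n" "d + 1"] by auto
  moreover have "shatters_some_of_size X F (Suc n)" if "n < d"
    using not_less_Least[OF that[unfolded d_def]] by simp
  ultimately have "n < d \<longleftrightarrow> shatters_some_of_size X F (Suc n)"
    using not_less by blast
  with True show ?thesis
    by (simp add: vc_dim_def d_def)
next
  case False
  then show ?thesis
    by (simp add: vc_dim_def vc_class_def)
qed

lemma vc_dim_eq_infinity_iff: "vc_dim X F = \<infinity> \<longleftrightarrow> \<not> vc_class X F"
  by (simp add: vc_dim_def)

lemma free_set_imp_shattered:
  assumes "free_set g A" and "\<And>S. S \<subseteq> A \<Longrightarrow> g S \<in> F \<and> S \<subseteq> g S"
  shows "shattered F A"
  unfolding shattered_def
proof (intro allI impI)
  fix S assume "S \<subseteq> A"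
  with assms have "g S \<in> F" and "g S \<inter> A = S"
    unfolding free_set_def by blast+
  then show "\<exists>B\<in>F. B \<inter> A = S" by blast
qed

theorem less_vc_dim_if_covers_Fpow:
  assumes "Cinfinite r" and "cardSuc_iter_ordLeq r n X"
    and small: "\<And>B. B \<in> F \<Longrightarrow> |B| <o r"
    and covers: "\<forall>A\<in>Fpow X. \<exists>B\<in>F. A \<subseteq> B"
  shows "enat n < vc_dim X F"
proof -
  obtain g where g: "\<And>S. S \<in> Fpow X \<Longrightarrow> g S \<in> F \<and> S \<subseteq> g S"
    using covers by metis
  then have "|g S| <o r" if "S \<in> Fpow X" for S
    using that small by blast
  then obtain A where A: "A \<in> Fpow X" "card A = Suc n" and free: "free_set g A"
    using Kuratowski_free_set[OF assms(1,2)] unfolding admits_free_sets_def by blast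
  have "shattered F A"
    using free g[OF Fpow_subset[OF A(1)]] by (rule free_set_imp_shattered)
  with A have "shatters_some_of_size X F (Suc n)"
    unfolding shatters_some_of_size_def by (auto simp: Fpow_def)
  then show ?thesis
    by (simp add: less_vc_dim_iff)
qed

theorem proposition3p3:
  fixes X :: "'a set" and F :: "'a set set"
  assumes "F \<subseteq> Fpow X"
    and "\<forall>A\<in>Fpow X. \<exists>B\<in>F. A \<subseteq> B"
  shows "(\<forall>n. aleph_le n |X| \<longrightarrow> vc_dim X F > enat n) \<and>
         (aleph_omega_le |X| \<longrightarrow> vc_dim X F = \<infinity> \<and> \<not> vc_class X F)"
proof -
  have "|B| <o natLeq" if "B \<in> F" for B
    using that assms(1) by (auto simp: Fpow_def finite_iff_ordLess_natLeq[symmetric])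
  then have finite_aleph: "enat n < vc_dim X F" if "aleph_le n |X|" for n
    using natLeq_Cinfinite aleph_le_imp_cardSuc_iter_natLeq[OF that] assms(2)
    by (intro less_vc_dim_if_covers_Fpow)
  have "vc_dim X F = \<infinity>" if "aleph_omega_le |X|"
  proof (rule ccontr)
    assume "vc_dim X F \<noteq> \<infinity>"
    then obtain n where "vc_dim X F = enat n" by auto
    with finite_aleph[OF aleph_omega_le_imp_aleph_le[OF that], of n] show False by simp
  qed
  with finite_aleph show ?thesis
    by (auto simp: vc_dim_eq_infinity_iff)
qed

end
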